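(* Let $\varphi$ be a nonnegative Borel function on the unit disc $\mathbb{D}$. Then there exists a (positive) harmonic function $h$ on $\mathbb{D}$ such that $h(z)\ge\varphi(z)$ for any $z\in\mathbb{D}$ if and only if there exists a constant $C=C(\varphi)$ such that for every positive Borel measure $\mu$ on $\mathbb{D}$, $$\int_{\mathbb{D}}\varphi(z)\,d\mu(z)\le C\sup_{\zeta\in\partial\mathbb{D}}\int_{\mathbb{D}}P_z(\zeta)\,d\mu(z).$$
   Context: $\mathbb{D}$ is the open unit disc and $P_z(\zeta)=\frac{1-|z|^2}{|\zeta-z|^2}$ ($z\in\mathbb{D}$, $\zeta\in\partial\mathbb{D}$) is the Poisson kernel. Both sides of the inequality may take the value $+\infty$. Positive harmonic means harmonic and $\ge0$. *)

theory Defs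
  imports "HOL-Analysis.Analysis"
begin

definition poisson_kernel :: "complex \<Rightarrow> complex \<Rightarrow> real" where
  "poisson_kernel z \<zeta> = (1 - (cmod z)\<^sup>2) / (cmod (\<zeta> - z))\<^sup>2"

text \<open>
  A real function on an open set of the plane is harmonic if it is of class $C^2$ and its
  Laplacian vanishes.  The witnesses are the first and second order partial derivatives with
  respect to \<open>x = Re z\<close> and \<open>y = Im z\<close>; \<open>uxy\<close> is the \<open>y\<close>-derivative of \<open>ux\<close>.
  Continuity of \<open>u\<close>, \<open>ux\<close> and \<open>uy\<close> follows from their differentiability.
\<close>

definition harmonic_on :: "complex set \<Rightarrow> (complex \<Rightarrow> real) \<Rightarrow> bool" where
  "harmonic_on S u \<longleftrightarrow> open S \<and>
     (\<exists>ux uy uxx uxy uyx uyy.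
        continuous_on S uxx \<and> continuous_on S uxy \<and> continuous_on S uyx \<and> continuous_on S uyy \<and>
        (\<forall>z\<in>S. (u has_derivative (\<lambda>w. ux z * Re w + uy z * Im w)) (at z) \<and>
               (ux has_derivative (\<lambda>w. uxx z * Re w + uxy z * Im w)) (at z) \<and>
               (uy has_derivative (\<lambda>w. uyx z * Re w + uyy z * Im w)) (at z) \<and>
               uxx z + uyy z = 0))"

end

theory Submission
  imports Defs "HOL-Complex_Analysis.Complex_Analysis"
begin

text \<open>
  If $h \ge \varphi$ is positive harmonic, the Poisson formula for the dilates $h(rz)$, Fubini and Fatou give
  $\int h\,d\mu \le h(0) \sup_\zeta \int P_z(\zeta)\,d\mu(z)$.
  Conversely, the positive harmonic functions $\mathrm{Re} \sum_n a_n z^n$ with $|a_n| \le 2C$ form a compact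
  convex family, so by the finite intersection property it suffices to dominate $\varphi$ on a finite set.
  There, minimise $\sum_i \max(0, \varphi(z_i) - h(z_i))^2$ over the family: if the minimum were positive, the
  first-order condition, tested against the functions $C P_z(\zeta)$, would contradict the hypothesis for the
  measure with mass $\max(0, \varphi(z_i) - h(z_i))$ at $z_i$.
\<close>

section \<open>Harmonic functions as real parts of holomorphic functions\<close>

lemma has_real_derivative_along_axis:
  fixes u :: "complex \<Rightarrow> real"
  shows has_real_derivative_along_real_axis:
    "(u has_derivative (\<lambda>w. p * Re w + q * Im w)) (at (c + of_real t)) \<Longrightarrow>
       ((\<lambda>t. u (c + of_real t)) has_real_derivative p) (at t)"
    and has_real_derivative_along_imaginary_axis:
    "(u has_derivative (\<lambda>w. p * Re w + q * Im w)) (at (c + of_real t * \<i>)) \<Longrightarrow>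
       ((\<lambda>t. u (c + of_real t * \<i>)) has_real_derivative q) (at t)"
proof -
  have *: "((\<lambda>t. u (c + of_real t * v)) has_real_derivative (p * Re v + q * Im v)) (at t)"
    if "(u has_derivative (\<lambda>w. p * Re w + q * Im w)) (at (c + of_real t * v))" for v
  proof -
    have "((\<lambda>t. c + of_real t * v) has_derivative (\<lambda>s. of_real s * v)) (at t)"
      by (auto intro!: derivative_eq_intros)
    from has_derivative_compose[OF this that]
    show ?thesis
      unfolding has_field_derivative_def
      by (rule has_derivative_eq_rhs) (simp add: fun_eq_iff algebra_simps)
  qed
  show "(u has_derivative (\<lambda>w. p * Re w + q * Im w)) (at (c + of_real t)) \<Longrightarrow>
       ((\<lambda>t. u (c + of_real t)) has_real_derivative p) (at t)"
    using *[of 1] by simp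
  show "(u has_derivative (\<lambda>w. p * Re w + q * Im w)) (at (c + of_real t * \<i>)) \<Longrightarrow>
       ((\<lambda>t. u (c + of_real t * \<i>)) has_real_derivative q) (at t)"
    using *[of \<i>] by simp
qed

text \<open>Schwarz's theorem on mixed partials, used because \<open>harmonic_on\<close> has
  separate witnesses for \<open>uxy\<close> and \<open>uyx\<close>. On a small square the second
  difference of \<open>u\<close>, divided by the squared side, is a value of each of them near
  \<open>z\<close>, and continuity then forces equality at \<open>z\<close>.\<close>

lemma mixed_partials_eq:
  fixes u :: "complex \<Rightarrow> real"
  assumes S: "open S" "z \<in> S"
    and u: "\<And>z. z \<in> S \<Longrightarrow> (u has_derivative (\<lambda>w. ux z * Re w + uy z * Im w)) (at z)"
    and ux: "\<And>z. z \<in> S \<Longrightarrow> (ux has_derivative (\<lambda>w. uxx z * Re w + uxy z * Im w)) (at z)"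
    and uy: "\<And>z. z \<in> S \<Longrightarrow> (uy has_derivative (\<lambda>w. uyx z * Re w + uyy z * Im w)) (at z)"
    and cont: "continuous_on S uxy" "continuous_on S uyx"
  shows "uxy z = uyx z"
proof (rule ccontr)
  assume "uxy z \<noteq> uyx z"
  \<comment> \<open>Half the gap: numbers at distance less than \<open>e\<close> from
    \<open>uxy z\<close> and from \<open>uyx z\<close> respectively cannot coincide.\<close>
  define e where "e = \<bar>uxy z - uyx z\<bar> / 2"
  have e: "e > 0" using \<open>uxy z \<noteq> uyx z\<close> by (simp add: e_def)
  have "(uxy \<longlongrightarrow> uxy z) (nhds z)" "(uyx \<longlongrightarrow> uyx z) (nhds z)"
    using cont S by (simp_all add: continuous_on_eq_continuous_at isCont_def tendsto_at_iff_tendsto_nhds)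
  from tendstoD[OF this(1) e] tendstoD[OF this(2) e]
  have "\<forall>\<^sub>F w in nhds z. dist (uxy w) (uxy z) < e" "\<forall>\<^sub>F w in nhds z. dist (uyx w) (uyx z) < e" .
  moreover have "\<forall>\<^sub>F w in nhds z. w \<in> S"
    using S by (rule eventually_nhds_in_open)
  ultimately have "\<forall>\<^sub>F w in nhds z. w \<in> S \<and> dist (uxy w) (uxy z) < e \<and> dist (uyx w) (uyx z) < e"
    by eventually_elim auto
  then obtain d where d: "d > 0"
    and near: "\<And>w. dist w z < d \<Longrightarrow> w \<in> S \<and> dist (uxy w) (uxy z) < e \<and> dist (uyx w) (uyx z) < e"
    unfolding eventually_nhds_metric by blast
  \<comment> \<open>Every point of the square of side \<open>s\<close> with corner \<open>z\<close>
    is within \<open>2 * s\<close> of \<open>z\<close>, hence closer than \<open>d\<close>.\<close>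
  define s where "s = d / 3"
  have s: "s > 0" using d by (simp add: s_def)
  have near': "dist (z + of_real a + of_real b * \<i>) z < d" if "0 \<le> a" "a \<le> s" "0 \<le> b" "b \<le> s" for a b
  proof -
    have "dist (z + of_real a + of_real b * \<i>) z = cmod (of_real a + of_real b * \<i>)"
      by (simp add: dist_norm algebra_simps)
    also have "\<dots> \<le> a + b"
      using norm_triangle_ineq[of "of_real a" "of_real b * \<i>"] that by (simp add: norm_mult)
    also have "\<dots> < d" using that d by (simp add: s_def)
    finally show ?thesis .
  qed
  have inS: "z + of_real a + of_real b * \<i> \<in> S" if "0 \<le> a" "a \<le> s" "0 \<le> b" "b \<le> s" for a b
    using near[OF near'[OF that]] by blast
  \<comment> \<open>The second difference \<open>D\<close> is evaluated by the mean value theorem in both orders.\<close>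
  define D where "D = u (z + of_real s + of_real s * \<i>) - u (z + of_real s)
                    - u (z + of_real s * \<i>) + u z"
  \<comment> \<open>\<open>D\<close> is the horizontal increment of the difference of
    \<open>u\<close> between the upper and the lower edge. The \<open>of_real 0\<close> terms keep
    the endpoint 0 in the form that \<open>MVT2\<close> produces.\<close>
  have "\<exists>a>0. a < s \<and> (u (z + of_real s * \<i> + of_real s) - u (z + of_real s))
           - (u (z + of_real s * \<i> + of_real 0) - u (z + of_real 0))
       = (s - 0) * (ux (z + of_real s * \<i> + of_real a) - ux (z + of_real a))"
  proof (rule MVT2)
    fix a assume a: "0 \<le> a" "a \<le> s"
    have "z + of_real s * \<i> + of_real a \<in> S" "z + of_real a \<in> S"
      using inS[of a s] inS[of a 0] a s by (simp_all add: algebra_simps)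
    then show "((\<lambda>a. u (z + of_real s * \<i> + of_real a) - u (z + of_real a)) has_real_derivative
       (ux (z + of_real s * \<i> + of_real a) - ux (z + of_real a))) (at a)"
      by (intro DERIV_diff has_real_derivative_along_real_axis[OF u])
  qed (use s in auto)
  then obtain a where a: "0 < a" "a < s"
    "D = s * (ux (z + of_real a + of_real s * \<i>) - ux (z + of_real a))"
    by (auto simp: D_def algebra_simps)
  have "\<exists>b>0. b < s \<and> ux (z + of_real a + of_real s * \<i>) - ux (z + of_real a + of_real 0 * \<i>)
           = (s - 0) * uxy (z + of_real a + of_real b * \<i>)"
  proof (rule MVT2)
    fix b assume b: "0 \<le> b" "b \<le> s"
    have "z + of_real a + of_real b * \<i> \<in> S"
      using inS[of a b] a b by simp
    then show "((\<lambda>b. ux (z + of_real a + of_real b * \<i>)) has_real_derivative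
       uxy (z + of_real a + of_real b * \<i>)) (at b)"
      by (intro has_real_derivative_along_imaginary_axis[OF ux])
  qed (use s in auto)
  then obtain b where b: "0 < b" "b < s" "D = s * (s * uxy (z + of_real a + of_real b * \<i>))"
    using a by auto
  \<comment> \<open>The same with the two directions exchanged, which leads to
    \<open>uyx\<close>.\<close>
  have "\<exists>b>0. b < s \<and> (u (z + of_real s + of_real s * \<i>) - u (z + of_real s * \<i>))
           - (u (z + of_real s + of_real 0 * \<i>) - u (z + of_real 0 * \<i>))
       = (s - 0) * (uy (z + of_real s + of_real b * \<i>) - uy (z + of_real b * \<i>))"
  proof (rule MVT2)
    fix b assume b: "0 \<le> b" "b \<le> s"
    have "z + of_real s + of_real b * \<i> \<in> S" "z + of_real b * \<i> \<in> S"
      using inS[of s b] inS[of 0 b] b s by simp_all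
    then show "((\<lambda>b. u (z + of_real s + of_real b * \<i>) - u (z + of_real b * \<i>)) has_real_derivative
       (uy (z + of_real s + of_real b * \<i>) - uy (z + of_real b * \<i>))) (at b)"
      by (intro DERIV_diff has_real_derivative_along_imaginary_axis[OF u])
  qed (use s in auto)
  then obtain b' where b': "0 < b'" "b' < s"
    "D = s * (uy (z + of_real s + of_real b' * \<i>) - uy (z + of_real b' * \<i>))"
    by (auto simp: D_def algebra_simps)
  have "\<exists>a>0. a < s \<and> uy (z + of_real b' * \<i> + of_real s) - uy (z + of_real b' * \<i> + of_real 0)
           = (s - 0) * uyx (z + of_real b' * \<i> + of_real a)"
  proof (rule MVT2)
    fix a assume a: "0 \<le> a" "a \<le> s"
    have "z + of_real b' * \<i> + of_real a \<in> S"
      using inS[of a b'] a b' by (simp add: algebra_simps)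
    then show "((\<lambda>a. uy (z + of_real b' * \<i> + of_real a)) has_real_derivative
       uyx (z + of_real b' * \<i> + of_real a)) (at a)"
      by (intro has_real_derivative_along_real_axis[OF uy])
  qed (use s in auto)
  then obtain a' where a': "0 < a'" "a' < s"
      "D = s * (s * uyx (z + of_real a' + of_real b' * \<i>))"
    using b' by (auto simp: algebra_simps)
  have "uxy (z + of_real a + of_real b * \<i>) = uyx (z + of_real a' + of_real b' * \<i>)"
    using a'(3) b(3) s by simp
  moreover have "dist (uxy (z + of_real a + of_real b * \<i>)) (uxy z) < e"
       "dist (uyx (z + of_real a' + of_real b' * \<i>)) (uyx z) < e"
    using near[OF near'[of a b]] near[OF near'[of a' b']] a(1,2) b(1,2) a'(1,2) b'(1,2) by auto
  ultimately show False
    by (simp add: e_def dist_real_def abs_if split: if_splits)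
qed

text \<open>The function \<open>g\<close>, that is \<open>ux\<close> minus i times
  \<open>uy\<close>, is holomorphic and has a primitive \<open>G\<close> on the convex set. Since
  \<open>Re (G z)\<close> and \<open>h\<close> have the same gradient, they differ by a real
  constant, which is added to \<open>G\<close>.\<close>

lemma harmonic_on_convex_imp_Re_holomorphic:
  assumes h: "harmonic_on S h" and S: "convex S"
  obtains F where "F holomorphic_on S" "\<And>z. z \<in> S \<Longrightarrow> h z = Re (F z)"
proof -
  obtain ux uy uxx uxy uyx uyy where op: "open S"
    and cont: "continuous_on S uxy" "continuous_on S uyx"
    and u: "\<And>z. z \<in> S \<Longrightarrow> (h has_derivative (\<lambda>w. ux z * Re w + uy z * Im w)) (at z)"
    and ux: "\<And>z. z \<in> S \<Longrightarrow> (ux has_derivative (\<lambda>w. uxx z * Re w + uxy z * Im w)) (at z)"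
    and uy: "\<And>z. z \<in> S \<Longrightarrow> (uy has_derivative (\<lambda>w. uyx z * Re w + uyy z * Im w)) (at z)"
    and lap: "\<And>z. z \<in> S \<Longrightarrow> uxx z + uyy z = 0"
    using h unfolding harmonic_on_def by (elim conjE exE) (rule that; blast)
  have sym: "uxy z = uyx z" if "z \<in> S" for z
    using mixed_partials_eq[OF op that u ux uy cont] .
  define g where "g z = Complex (ux z) (- uy z)" for z
  have g: "(g has_field_derivative Complex (uxx z) (- uyx z)) (at z)" if z: "z \<in> S" for z
  proof -
    have "uyy z = - uxx z" using lap[OF z] by simp
    have "g = (\<lambda>z. of_real (ux z) - \<i> * of_real (uy z))"
      by (simp add: fun_eq_iff complex_eq_iff g_def)
    moreover have "((\<lambda>z. of_real (ux z) - \<i> * of_real (uy z)) has_derivative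
        (\<lambda>w. of_real (uxx z * Re w + uxy z * Im w) - \<i> * of_real (uyx z * Re w + uyy z * Im w))) (at z)"
      by (intro has_derivative_diff has_derivative_mult_right has_derivative_of_real ux uy z)
    \<comment> \<open>The Cauchy-Riemann equations for \<open>g\<close>: equality of the mixed
      partials and the vanishing Laplacian turn the real-linear derivative into multiplication by a
      complex number.\<close>
    moreover have "(\<lambda>w. of_real (uxx z * Re w + uxy z * Im w) - \<i> * of_real (uyx z * Re w + uyy z * Im w))
        = (*) (Complex (uxx z) (- uyx z))"
      by (simp add: fun_eq_iff complex_eq_iff sym[OF z] \<open>uyy z = - uxx z\<close>)
    ultimately show ?thesis
      unfolding has_field_derivative_def by simp
  qed
  have "g holomorphic_on S"
    using g op by (auto simp: holomorphic_on_open)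
  then obtain G where G: "\<And>z. z \<in> S \<Longrightarrow> (G has_field_derivative g z) (at z within S)"
    using holomorphic_convex_primitive'[OF S op] by blast
  then have G': "(G has_field_derivative g z) (at z)" if "z \<in> S" for z
    using at_within_open[OF that op] that by metis
  have "\<exists>c. \<forall>z\<in>S. h z - Re (G z) = c"
  proof (rule has_derivative_zero_constant[OF S])
    fix z assume z: "z \<in> S"
    have "((\<lambda>z. h z - Re (G z)) has_derivative (\<lambda>w. ux z * Re w + uy z * Im w - Re (g z * w))) (at z)"
      using G'[OF z] unfolding has_field_derivative_def
      by (intro has_derivative_diff has_derivative_Re u z)
    then show "((\<lambda>z. h z - Re (G z)) has_derivative (\<lambda>w. 0)) (at z within S)"
      by (rule has_derivative_at_withinI[OF has_derivative_eq_rhs]) (simp add: g_def)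
  qed
  then obtain c where c: "\<And>z. z \<in> S \<Longrightarrow> h z - Re (G z) = c"
    by blast
  show thesis
  proof
    show "(\<lambda>z. G z + of_real c) holomorphic_on S"
      using G' op by (intro holomorphic_intros) (auto simp: holomorphic_on_open)
    show "h z = Re (G z + of_real c)" if "z \<in> S" for z
      using c[OF that] by simp
  qed
qed

text \<open>The partial derivatives are read off from \<open>deriv F\<close> and
  \<open>deriv (deriv F)\<close>: differentiation in y multiplies by i before the real part is
  taken, so it yields minus the imaginary part, and doing so twice changes the sign.\<close>

lemma harmonic_on_Re_holomorphic:
  assumes "F holomorphic_on S" "open S"
  shows "harmonic_on S (\<lambda>z. Re (F z))"
proof -
  have F: "(F has_field_derivative deriv F z) (at z)"
       "(deriv F has_field_derivative deriv (deriv F) z) (at z)" if "z \<in> S" for z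
    using assms that by (auto intro!: holomorphic_derivI holomorphic_deriv)
  have cont: "continuous_on S (deriv (deriv F))"
    using assms by (intro holomorphic_on_imp_continuous_on holomorphic_deriv)
  show ?thesis
    unfolding harmonic_on_def
  proof (intro conjI exI ballI)
    show "continuous_on S (\<lambda>z. Re (deriv (deriv F) z))"
      "continuous_on S (\<lambda>z. - Im (deriv (deriv F) z))"
      "continuous_on S (\<lambda>z. - Im (deriv (deriv F) z))"
      "continuous_on S (\<lambda>z. - Re (deriv (deriv F) z))"
      using cont by (auto intro!: continuous_intros)
    fix z assume z: "z \<in> S"
    show "((\<lambda>z. Re (F z)) has_derivative (\<lambda>w. Re (deriv F z) * Re w + - Im (deriv F z) * Im w)) (at z)"
      "((\<lambda>z. Re (deriv F z)) has_derivative (\<lambda>w. Re (deriv (deriv F) z) * Re w + - Im (deriv (deriv F) z) * Im w)) (at z)"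
      using F[OF z] unfolding has_field_derivative_def
      by (auto dest!: has_derivative_Re)
    show "((\<lambda>z. - Im (deriv F z)) has_derivative (\<lambda>w. - Im (deriv (deriv F) z) * Re w + - Re (deriv (deriv F) z) * Im w)) (at z)"
      using has_derivative_minus[OF has_derivative_Im[OF F(2)[OF z, unfolded has_field_derivative_def]]]
      by (simp add: algebra_simps)
  qed (use assms in auto)
qed

section \<open>The Poisson kernel and the Poisson integral formula\<close>

lemma poisson_kernel_nonneg:
  assumes "cmod z \<le> 1"
  shows "0 \<le> poisson_kernel z \<zeta>"
  using assms by (simp add: poisson_kernel_def power_le_one)

lemma poisson_kernel_pos:
  assumes "cmod z < 1" "cmod \<zeta> = 1"
  shows "0 < poisson_kernel z \<zeta>"
proof -
  have "(cmod z)\<^sup>2 < 1" using assms by (simp add: power_less_one_iff)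
  moreover have "\<zeta> \<noteq> z" using assms by auto
  ultimately show ?thesis by (simp add: poisson_kernel_def)
qed

text \<open>On the unit circle the conjugate of \<zeta> is its inverse, so the squared distance in
  the denominator becomes a rational function of \<zeta>. In this form the kernel can be compared
  with a Cauchy kernel.\<close>

lemma of_real_poisson_kernel:
  assumes "cmod \<zeta> = 1"
  shows "complex_of_real (poisson_kernel z \<zeta>) = (1 - cnj z * z) * \<zeta> / ((1 - cnj z * \<zeta>) * (\<zeta> - z))"
proof -
  have 1: "\<zeta> * cnj \<zeta> = 1"
    using assms by (simp flip: complex_norm_square)
  then have "1 - cnj z * \<zeta> = \<zeta> * cnj (\<zeta> - z)"
    by (simp add: algebra_simps)
  moreover have "complex_of_real (poisson_kernel z \<zeta>) = (1 - z * cnj z) / ((\<zeta> - z) * cnj (\<zeta> - z))"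
    by (simp add: poisson_kernel_def complex_norm_square flip: of_real_power)
  moreover have "\<zeta> \<noteq> 0" using assms by auto
  ultimately show ?thesis by (simp add: mult_ac)
qed

lemma poisson_integral_formula:
  assumes cont: "continuous_on (cball 0 1) F" and hol: "F holomorphic_on ball 0 1" and z: "cmod z < 1"
  shows "((\<lambda>t. of_real (poisson_kernel z (cis (2 * pi * t))) * F (cis (2 * pi * t)))
           has_integral F z) {0..1}"
proof -
  \<comment> \<open>\<open>G\<close> agrees with \<open>F\<close> at \<open>z\<close>, and its Cauchy kernel on the unit circle is the Poisson kernel.\<close>
  define G where "G u = F u * (1 - cnj z * z) / (1 - cnj z * u)" for u
  \<comment> \<open>The only possible zero of the denominator of \<open>G\<close> is the reflection
    of \<open>z\<close> in the unit circle, which lies outside the closed disc.\<close>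
  have nz: "1 - cnj z * u \<noteq> 0" if "cmod u \<le> 1" for u
  proof
    assume "1 - cnj z * u = 0"
    then have "cmod (cnj z * u) = 1" by (simp flip: eq_iff_diff_eq_0)
    moreover have "cmod (cnj z * u) < 1"
      using mult_left_le[OF that, of "cmod z"] z by (simp add: norm_mult)
    ultimately show False by simp
  qed
  have "continuous_on (cball 0 1) G" "G holomorphic_on ball 0 1"
    unfolding G_def using cont hol nz by (auto intro!: continuous_intros holomorphic_intros)
  have circlepath_eq: "circlepath 0 1 t = cis (2 * pi * t)"
    and exp_eq: "exp (2 * of_real pi * \<i> * of_real t) = cis (2 * pi * t)" for t
    by (simp_all add: circlepath cis_conv_exp mult_ac)
  from Cauchy_integral_circlepath[OF \<open>continuous_on _ G\<close> \<open>G holomorphic_on _\<close>, of z] z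
  have "((\<lambda>u. G u / (u - z)) has_contour_integral (2 * of_real pi * \<i> * G z)) (circlepath 0 1)"
    by simp
  moreover have "G z = F z" using nz[of z] z by (simp add: G_def)
  ultimately have "((\<lambda>t. G (cis (2 * pi * t)) / (cis (2 * pi * t) - z) * (2 * pi * \<i> * cis (2 * pi * t)))
      has_integral (2 * of_real pi * \<i> * F z)) {0..1}"
    unfolding has_contour_integral vector_derivative_circlepath circlepath_eq exp_eq by simp
  \<comment> \<open>Together with the factor \<zeta> from the derivative of the circle path this
    leaves normalised arc length, parametrised by \<open>t\<close> in \<open>{0..1}\<close>.\<close>
  from has_integral_mult_right[OF this, of "1 / (2 * of_real pi * \<i>)"]
  show ?thesis
    by (simp add: G_def of_real_poisson_kernel mult_ac)
qed

text \<open>\<open>F\<close> need not extend to the closed disc, but its dilate by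
  \<open>r < 1\<close> is continuous there, so the Poisson formula applies to the dilate.
  Nonnegativity of the real part allows the result to be written as a \<open>nn_integral\<close>,
  ready for Fubini.\<close>

lemma nn_integral_poisson_kernel:
  assumes hol: "F holomorphic_on ball 0 1" and pos: "\<And>z. z \<in> ball 0 1 \<Longrightarrow> 0 \<le> Re (F z)"
    and z: "cmod z < 1" and r: "0 \<le> r" "r < 1"
  shows "(\<integral>\<^sup>+t. ennreal (poisson_kernel z (cis (2 * pi * t)) * Re (F (of_real r * cis (2 * pi * t))))
           * indicator {0..1} t \<partial>lborel) = ennreal (Re (F (of_real r * z)))"
proof -
  have le: "cmod (of_real r * u) < 1" if "cmod u \<le> 1" for u
    using mult_left_le[OF that, of r] r by (simp add: norm_mult)
  have cont: "continuous_on (cball 0 1) (\<lambda>u. F (of_real r * u))"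
    by (intro continuous_on_compose2[OF holomorphic_on_imp_continuous_on[OF hol]] continuous_intros)
       (use le in auto)
  have hol': "(\<lambda>u. F (of_real r * u)) holomorphic_on ball 0 1"
    by (intro holomorphic_on_compose_gen[OF _ hol, unfolded o_def] holomorphic_intros)
       (use le in \<open>auto simp: less_imp_le\<close>)
  have "((\<lambda>t. Re (of_real (poisson_kernel z (cis (2 * pi * t))) * F (of_real r * cis (2 * pi * t))))
           has_integral Re (F (of_real r * z))) {0..1}"
    using has_integral_Re[OF poisson_integral_formula[OF cont hol' z]] by simp
  then have "((\<lambda>t. poisson_kernel z (cis (2 * pi * t)) * Re (F (of_real r * cis (2 * pi * t))))
           has_integral Re (F (of_real r * z))) {0..1}"
    by simp
  then show ?thesis
    by (intro nn_integral_has_integral_lebesgue') (use le z in \<open>auto intro!: mult_nonneg_nonneg pos poisson_kernel_nonneg\<close>)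
qed

section \<open>The integral inequality for positive harmonic functions\<close>

text \<open>By Markov's inequality the sets where \<open>f\<close> is at least 1/n have finite
  measure, and they exhaust the space because \<open>f\<close> is positive. This makes Fubini
  available for the given measure \<mu>.\<close>

lemma sigma_finite_measure_positive_integrable:
  fixes f :: "'a \<Rightarrow> real"
  assumes [measurable]: "f \<in> borel_measurable M" and pos: "\<And>x. x \<in> space M \<Longrightarrow> 0 < f x"
    and fin: "(\<integral>\<^sup>+x. ennreal (f x) \<partial>M) < \<infinity>"
  shows "sigma_finite_measure M"
proof
  define A where "A n = {x \<in> space M. 1 \<le> of_nat n * ennreal (f x)}" for n :: nat
  have "A n \<in> sets M" for n unfolding A_def by measurable
  moreover have "\<Union>(range A) = space M"
  proof (intro equalityI subsetI)
    fix x assume x: "x \<in> space M"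
    obtain n where "1 < of_nat n * f x" using reals_Archimedean3[OF pos[OF x]] by blast
    then have "ennreal 1 \<le> ennreal (of_nat n * f x)" by (intro ennreal_leI) simp
    then have "x \<in> A n" using x pos[OF x]
      by (simp add: A_def ennreal_mult' ennreal_of_nat_eq_real_of_nat)
    then show "x \<in> \<Union>(range A)" by blast
  qed (auto simp: A_def)
  moreover have "emeasure M (A n) \<noteq> \<infinity>" for n
  proof -
    have "emeasure M (A n) \<le> of_nat n * (\<integral>\<^sup>+x. ennreal (f x) * indicator (space M) x \<partial>M)"
      using nn_integral_Markov_inequality[of "\<lambda>x. ennreal (f x)" "space M" M "of_nat n"]
      unfolding A_def by simp
    also have "\<dots> = of_nat n * (\<integral>\<^sup>+x. ennreal (f x) \<partial>M)"
      by (simp cong: nn_integral_cong)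
    also have "\<dots> < \<infinity>" using fin by (simp add: ennreal_mult_less_top of_nat_less_top)
    finally show ?thesis by simp
  qed
  ultimately show "\<exists>A. countable A \<and> A \<subseteq> sets M \<and> \<Union>A = space M \<and> (\<forall>a\<in>A. emeasure M a \<noteq> \<infinity>)"
    by (intro exI[of _ "range A"]) auto
qed

lemma borel_measurable_poisson_kernel [measurable (raw)]:
  assumes [measurable]: "f \<in> borel_measurable M" "g \<in> borel_measurable M"
  shows "(\<lambda>x. poisson_kernel (f x) (g x)) \<in> borel_measurable M"
  unfolding poisson_kernel_def by measurable

text \<open>The Poisson formula makes each dilate a weighted average of Poisson kernels over the
  circle. After exchanging the integrals, the inner one is at most the supremum, and the total
  weight is \<open>Re (F 0)\<close>. The assumption \<open>fin\<close> supplies the sigma-finiteness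
  for the exchange.\<close>

lemma nn_integral_Re_le_SUP_poisson:
  fixes \<mu> :: "complex measure"
  assumes hol: "F holomorphic_on ball 0 1" and pos: "\<And>z. z \<in> ball 0 1 \<Longrightarrow> 0 \<le> Re (F z)"
    and sets_\<mu>: "sets \<mu> = sets (restrict_space borel (ball 0 1))"
    and fin: "(SUP \<zeta>\<in>sphere 0 1. \<integral>\<^sup>+z. ennreal (poisson_kernel z \<zeta>) \<partial>\<mu>) < \<infinity>"
  shows "(\<integral>\<^sup>+z. ennreal (Re (F z)) \<partial>\<mu>)
     \<le> ennreal (Re (F 0)) * (SUP \<zeta>\<in>sphere 0 1. \<integral>\<^sup>+z. ennreal (poisson_kernel z \<zeta>) \<partial>\<mu>)"
    (is "_ \<le> _ * ?S")
proof -
  have space_\<mu>: "space \<mu> = ball 0 1"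
    using sets_eq_imp_space_eq[OF sets_\<mu>] by (simp add: space_restrict_space)
  have [measurable]: "(\<lambda>z. z) \<in> borel_measurable \<mu>"
    unfolding measurable_cong_sets[OF sets_\<mu> refl] by (intro measurable_restrict_space1) simp
  have upper: "(\<integral>\<^sup>+z. ennreal (poisson_kernel z \<zeta>) \<partial>\<mu>) \<le> ?S" if "cmod \<zeta> = 1" for \<zeta>
    by (rule SUP_upper) (use that in simp)
  \<comment> \<open>The kernel at the boundary point 1 is positive on the disc, and its integral is
    bounded by the finite supremum.\<close>
  interpret \<mu>: sigma_finite_measure \<mu>
  proof (rule sigma_finite_measure_positive_integrable)
    show "(\<integral>\<^sup>+z. ennreal (poisson_kernel z 1) \<partial>\<mu>) < \<infinity>"
      using upper[of 1] fin by (simp add: less_le_trans le_less_trans)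
  qed (auto simp: space_\<mu> poisson_kernel_pos)
  interpret pair_sigma_finite \<mu> "lborel :: real measure" ..
  have dilate: "(\<integral>\<^sup>+z. ennreal (Re (F (of_real r * z))) \<partial>\<mu>) \<le> ennreal (Re (F 0)) * ?S"
    if r: "0 \<le> r" "r < 1" for r
  proof -
    define h where "h t = Re (F (of_real r * cis (2 * pi * t)))" for t
    have "continuous_on UNIV h"
      unfolding h_def
      by (intro continuous_intros continuous_on_compose2[OF holomorphic_on_imp_continuous_on[OF hol]])
         (use r in \<open>auto simp: norm_mult\<close>)
    then have [measurable]: "h \<in> borel_measurable borel"
      by (rule borel_measurable_continuous_onI)
    have h_nonneg: "0 \<le> h t" for t
      unfolding h_def by (rule pos) (use r in \<open>simp add: norm_mult\<close>)
    have "continuous_on UNIV (\<lambda>t. cis (2 * pi * t))"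
      by (intro continuous_intros)
    then have [measurable]: "(\<lambda>t. cis (2 * pi * t)) \<in> borel_measurable borel"
      by (rule borel_measurable_continuous_onI)
    \<comment> \<open>At \<open>z = 0\<close> the Poisson kernel is constantly 1, and the formula
      becomes the mean value property.\<close>
    have mean: "(\<integral>\<^sup>+t. ennreal (h t) * indicator {0..1} t \<partial>lborel) = ennreal (Re (F 0))"
      using nn_integral_poisson_kernel[OF hol pos _ r, of 0]
      by (simp add: poisson_kernel_def h_def)
    have "(\<integral>\<^sup>+z. ennreal (Re (F (of_real r * z))) \<partial>\<mu>)
      = (\<integral>\<^sup>+z. (\<integral>\<^sup>+t. ennreal (poisson_kernel z (cis (2 * pi * t)) * h t) * indicator {0..1} t \<partial>lborel) \<partial>\<mu>)"
      using nn_integral_poisson_kernel[OF hol pos _ r]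
      by (intro nn_integral_cong) (simp add: space_\<mu> h_def)
    also have "\<dots> = (\<integral>\<^sup>+t. (\<integral>\<^sup>+z. ennreal (poisson_kernel z (cis (2 * pi * t)) * h t) * indicator {0..1} t \<partial>\<mu>) \<partial>lborel)"
      by (rule Fubini'[symmetric]) measurable
    also have "\<dots> \<le> (\<integral>\<^sup>+t. ennreal (h t) * indicator {0..1} t * ?S \<partial>lborel)"
    proof (rule nn_integral_mono)
      fix t
      have "(\<integral>\<^sup>+z. ennreal (poisson_kernel z (cis (2 * pi * t)) * h t) * indicator {0..1} t \<partial>\<mu>)
          = (\<integral>\<^sup>+z. (ennreal (h t) * indicator {0..1} t) * ennreal (poisson_kernel z (cis (2 * pi * t))) \<partial>\<mu>)"
        by (intro nn_integral_cong)
           (simp add: space_\<mu> ennreal_mult h_nonneg poisson_kernel_nonneg less_imp_le mult_ac)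
      also have "\<dots> = ennreal (h t) * indicator {0..1} t * (\<integral>\<^sup>+z. ennreal (poisson_kernel z (cis (2 * pi * t))) \<partial>\<mu>)"
        by (rule nn_integral_cmult) measurable
      also have "\<dots> \<le> ennreal (h t) * indicator {0..1} t * ?S"
        by (intro mult_left_mono upper) auto
      finally show "(\<integral>\<^sup>+z. ennreal (poisson_kernel z (cis (2 * pi * t)) * h t) * indicator {0..1} t \<partial>\<mu>)
          \<le> ennreal (h t) * indicator {0..1} t * ?S" .
    qed
    also have "\<dots> = ennreal (Re (F 0)) * ?S"
      by (subst nn_integral_multc) (simp_all add: mean)
    finally show ?thesis .
  qed
  define r :: "nat \<Rightarrow> real" where "r n = 1 - 1 / (real n + 1)" for n
  have r: "0 \<le> r n" "r n < 1" for n by (auto simp: r_def field_simps)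
  have r_lim: "r \<longlonglongrightarrow> 1"
    unfolding r_def using LIMSEQ_inverse_real_of_nat_add_minus[of 1]
    by (simp add: field_simps)
  have F_cont: "continuous_on (ball 0 1) F" by (rule holomorphic_on_imp_continuous_on[OF hol])
  have rz: "of_real (r n) * z \<in> ball 0 1" if "z \<in> ball 0 1" for n and z :: complex
    using mult_left_le_one_le[of "cmod z" "r n"] r[of n] that by (simp add: norm_mult)
  \<comment> \<open>The dilates converge pointwise to \<open>F\<close>. The limit is written as a
    \<open>liminf\<close> so that Fatou's lemma carries the bound over to \<open>F\<close>.\<close>
  have "(\<integral>\<^sup>+z. ennreal (Re (F z)) \<partial>\<mu>) = (\<integral>\<^sup>+z. liminf (\<lambda>n. ennreal (Re (F (of_real (r n) * z)))) \<partial>\<mu>)"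
  proof (rule nn_integral_cong)
    fix z assume "z \<in> space \<mu>"
    then have z: "z \<in> ball 0 1" by (simp add: space_\<mu>)
    have "(\<lambda>n. of_real (r n) * z) \<longlonglongrightarrow> of_real 1 * z"
      by (intro tendsto_intros r_lim)
    then have "(\<lambda>n. F (of_real (r n) * z)) \<longlonglongrightarrow> F (of_real 1 * z)"
      by (intro continuous_on_tendsto_compose[OF F_cont]) (use z rz in auto)
    then have "(\<lambda>n. ennreal (Re (F (of_real (r n) * z)))) \<longlonglongrightarrow> ennreal (Re (F z))"
      by (intro tendsto_ennrealI tendsto_Re) simp
    then show "ennreal (Re (F z)) = liminf (\<lambda>n. ennreal (Re (F (of_real (r n) * z))))"
      by (intro lim_imp_Liminf[symmetric]) auto
  qed
  also have "\<dots> \<le> liminf (\<lambda>n. \<integral>\<^sup>+z. ennreal (Re (F (of_real (r n) * z))) \<partial>\<mu>)"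
  proof (rule nn_integral_liminf)
    fix n
    have "continuous_on (ball 0 1) (\<lambda>z. Re (F (of_real (r n) * z)))"
      by (intro continuous_intros continuous_on_compose2[OF F_cont]) (use rz in auto)
    then show "(\<lambda>z. ennreal (Re (F (of_real (r n) * z)))) \<in> borel_measurable \<mu>"
      unfolding measurable_cong_sets[OF sets_\<mu> refl]
      by (intro measurable_compose[OF borel_measurable_continuous_on_restrict] measurable_ennreal)
  qed
  also have "\<dots> \<le> liminf (\<lambda>n::nat. ennreal (Re (F 0)) * ?S)"
    by (intro Liminf_mono always_eventually allI dilate r)
  also have "\<dots> = ennreal (Re (F 0)) * ?S" by (simp add: Liminf_const)
  finally show ?thesis .
qed

section \<open>A duality principle on compact convexlike families\<close>

text \<open>Least squares: let \<open>a\<close> minimise the sum \<open>q\<close> of squared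
  deficits, and take the deficits \<open>m\<close> at \<open>a\<close> as weights in
  \<open>dual\<close>. The resulting \<open>b\<close> would decrease \<open>q\<close> to first order
  if \<open>q a\<close> were positive. The assumption \<open>convexlike\<close> takes the place of a
  segment from \<open>a\<close> to \<open>b\<close> inside \<open>K\<close>.\<close>

lemma convexlike_dominating_point_finite:
  fixes e :: "'i \<Rightarrow> 'a::topological_space \<Rightarrow> real"
  assumes K: "compact K" and cont: "\<And>i. i \<in> J \<Longrightarrow> continuous_on K (e i)" and J: "finite J"
    and convexlike: "\<And>a b t. a \<in> K \<Longrightarrow> b \<in> K \<Longrightarrow> 0 \<le> t \<Longrightarrow> t \<le> 1 \<Longrightarrow>
                       \<exists>c\<in>K. \<forall>i\<in>J. (1 - t) * e i a + t * e i b \<le> e i c"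
    and dual: "\<And>m. (\<And>i. i \<in> J \<Longrightarrow> 0 \<le> m i) \<Longrightarrow>
                       \<exists>b\<in>K. (\<Sum>i\<in>J. m i * \<phi> i) \<le> (\<Sum>i\<in>J. m i * e i b)"
  shows "\<exists>a\<in>K. \<forall>i\<in>J. \<phi> i \<le> e i a"
proof -
  define q where "q a = (\<Sum>i\<in>J. (max 0 (\<phi> i - e i a))\<^sup>2)" for a
  \<comment> \<open>Zero weights already make \<open>dual\<close> produce a point of
    \<open>K\<close>.\<close>
  have "K \<noteq> {}" using dual[of "\<lambda>_. 0"] by auto
  moreover have "continuous_on K q"
    unfolding q_def by (intro continuous_intros cont)
  ultimately obtain a where a: "a \<in> K" and min: "\<And>c. c \<in> K \<Longrightarrow> q a \<le> q c"
    using continuous_attains_inf[OF K] by blast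
  define m where "m i = max 0 (\<phi> i - e i a)" for i
  obtain b where b: "b \<in> K" "(\<Sum>i\<in>J. m i * \<phi> i) \<le> (\<Sum>i\<in>J. m i * e i b)"
    using dual[of m] by (auto simp: m_def)
  define d where "d i = e i b - e i a" for i
  define D where "D = (\<Sum>i\<in>J. (d i)\<^sup>2)"
  have "D \<ge> 0" unfolding D_def by (intro sum_nonneg) auto
  \<comment> \<open>Each square equals \<open>m i * (\<phi> i - e i a)\<close>, since
    \<open>m i\<close> vanishes where the second factor is negative.\<close>
  have "q a = (\<Sum>i\<in>J. m i * \<phi> i - m i * e i a)"
    unfolding q_def m_def by (intro sum.cong) (auto simp: max_def power2_eq_square algebra_simps)
  also have "\<dots> \<le> (\<Sum>i\<in>J. m i * d i)"
    using b(2) by (simp add: d_def sum_subtractf right_diff_distrib)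
  finally have q_le: "q a \<le> (\<Sum>i\<in>J. m i * d i)" .
  \<comment> \<open>Compare \<open>q a\<close> with \<open>q c\<close>, where \<open>c\<close>
    dominates the point a fraction \<open>t\<close> of the way to \<open>b\<close>. The gain is
    linear in \<open>t\<close> and the loss quadratic; dividing by \<open>t\<close> gives the
    claim.\<close>
  have key: "2 * q a \<le> t * D" if t: "0 < t" "t \<le> 1" for t
  proof -
    obtain c where c: "c \<in> K" "\<And>i. i \<in> J \<Longrightarrow> (1 - t) * e i a + t * e i b \<le> e i c"
      using convexlike[OF a b(1), of t] t by auto
    have "q a \<le> q c" by (rule min[OF c(1)])
    also have "q c \<le> (\<Sum>i\<in>J. (m i - t * d i)\<^sup>2)"
      unfolding q_def
    proof (rule sum_mono)
      fix i assume "i \<in> J"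
      have "\<phi> i - e i c \<le> m i - t * d i"
        using c(2)[OF \<open>i \<in> J\<close>] by (simp add: m_def d_def algebra_simps)
      \<comment> \<open>When the right-hand base is negative, so is \<open>\<phi> i - e i c\<close>,
        and the left side is 0; squaring therefore preserves the bound.\<close>
      then show "(max 0 (\<phi> i - e i c))\<^sup>2 \<le> (m i - t * d i)\<^sup>2"
        by (cases "0 \<le> \<phi> i - e i c") (auto simp: max_def intro: power_mono)
    qed
    also have "\<dots> = (\<Sum>i\<in>J. (m i)\<^sup>2 - 2 * t * (m i * d i) + t\<^sup>2 * (d i)\<^sup>2)"
      by (intro sum.cong) (auto simp: power2_eq_square algebra_simps)
    also have "\<dots> = q a - 2 * t * (\<Sum>i\<in>J. m i * d i) + t\<^sup>2 * D"
      by (simp add: q_def m_def D_def sum.distrib sum_subtractf sum_distrib_left)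
    finally have "t * (2 * (\<Sum>i\<in>J. m i * d i)) \<le> t * (t * D)"
      by (simp add: power2_eq_square)
    then show ?thesis using t q_le by simp
  qed
  have "q a \<le> 0"
  proof (rule ccontr)
    assume "\<not> q a \<le> 0"
    then have q: "0 < q a" by simp
    \<comment> \<open>Small enough that \<open>t * D\<close> is at most \<open>q a\<close>, against
      the lower bound \<open>2 * q a\<close>. The 1 added to \<open>D\<close> avoids division by
      zero, and \<open>min 1\<close> keeps \<open>t\<close> in the range of
      \<open>key\<close>.\<close>
    define t where "t = min 1 (q a / (D + 1))"
    have t: "0 < t" "t \<le> 1" "t \<le> q a / (D + 1)" using q \<open>D \<ge> 0\<close> by (auto simp: t_def)
    have "t * D \<le> t * (D + 1)" using t by simp
    also have "\<dots> \<le> q a" using t(3) \<open>D \<ge> 0\<close> by (simp add: field_simps)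
    finally show False using key[OF t(1,2)] q by simp
  qed
  then have "q a = 0" unfolding q_def by (intro antisym sum_nonneg) auto
  then have "\<forall>i\<in>J. max 0 (\<phi> i - e i a) = 0"
    using J by (simp add: q_def sum_nonneg_eq_0_iff)
  then have "\<forall>i\<in>J. \<phi> i \<le> e i a" by (auto simp: max_def split: if_splits)
  then show ?thesis using a by blast
qed

text \<open>The finite case gives the finite intersection property for the sets of points satisfying
  one inequality. These are closed in the compact set \<open>K\<close>, so they have a common point.
  The class \<open>t2_space\<close> makes \<open>K\<close> itself closed.\<close>

lemma convexlike_dominating_point:
  fixes e :: "'i \<Rightarrow> 'a::t2_space \<Rightarrow> real"
  assumes K: "compact K" and cont: "\<And>i. i \<in> I \<Longrightarrow> continuous_on K (e i)"
    and convexlike: "\<And>a b t. a \<in> K \<Longrightarrow> b \<in> K \<Longrightarrow> 0 \<le> t \<Longrightarrow> t \<le> 1 \<Longrightarrow>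
                       \<exists>c\<in>K. \<forall>i\<in>I. (1 - t) * e i a + t * e i b \<le> e i c"
    and dual: "\<And>J m. finite J \<Longrightarrow> J \<subseteq> I \<Longrightarrow> (\<And>i. i \<in> J \<Longrightarrow> 0 \<le> m i) \<Longrightarrow>
                       \<exists>b\<in>K. (\<Sum>i\<in>J. m i * \<phi> i) \<le> (\<Sum>i\<in>J. m i * e i b)"
  shows "\<exists>a\<in>K. \<forall>i\<in>I. \<phi> i \<le> e i a"
proof -
  have "K \<inter> (\<Inter>i\<in>I. K \<inter> e i -` {\<phi> i..}) \<noteq> {}"
  proof (rule compact_imp_fip_image[OF K])
    show "closed (K \<inter> e i -` {\<phi> i..})" if "i \<in> I" for i
      by (intro continuous_closed_preimage cont that compact_imp_closed[OF K] closed_atLeast)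
    fix J assume J: "finite J" "J \<subseteq> I"
    have "\<exists>a\<in>K. \<forall>i\<in>J. \<phi> i \<le> e i a"
    proof (rule convexlike_dominating_point_finite[OF K _ J(1)])
      fix a b and t :: real assume "a \<in> K" "b \<in> K" "0 \<le> t" "t \<le> 1"
      then show "\<exists>c\<in>K. \<forall>i\<in>J. (1 - t) * e i a + t * e i b \<le> e i c"
        using convexlike J(2) by blast
    qed (use J cont dual in auto)
    then show "K \<inter> (\<Inter>i\<in>J. K \<inter> e i -` {\<phi> i..}) \<noteq> {}" by auto
  qed
  then obtain a where "a \<in> K" "a \<in> (\<Inter>i\<in>I. K \<inter> e i -` {\<phi> i..})"
    by blast
  then show ?thesis by blast
qed

section \<open>The compact convex family of positive power series\<close>

lemma bounded_coeffs_summable: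
  fixes a :: "nat \<Rightarrow> complex"
  assumes "\<And>n. cmod (a n) \<le> M" "cmod z < 1"
  shows "summable (\<lambda>n. a n * z ^ n)"
proof (rule summable_comparison_test')
  show "summable (\<lambda>n. M * cmod z ^ n)" using assms(2) by (intro summable_mult summable_geometric) simp
  show "cmod (a n * z ^ n) \<le> M * cmod z ^ n" for n
    using assms(1) by (simp add: norm_mult norm_power mult_right_mono)
qed

text \<open>Each partial sum involves finitely many coordinates and is continuous for the product
  topology. A geometric majorant makes the convergence uniform over all sequences bounded by
  \<open>M\<close>.\<close>

lemma continuous_on_power_series_coeffs:
  fixes z :: complex
  assumes "cmod z < 1"
  shows "continuous_on {a. \<forall>n. cmod (a n) \<le> M} (\<lambda>a. \<Sum>n. a n * z ^ n)"
proof (rule uniform_limit_theorem)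
  show "uniform_limit {a. \<forall>n. cmod (a n) \<le> M} (\<lambda>N a. \<Sum>n<N. a n * z ^ n) (\<lambda>a. \<Sum>n. a n * z ^ n) sequentially"
  proof (rule Weierstrass_m_test)
    show "summable (\<lambda>n. M * cmod z ^ n)" using assms by (intro summable_mult summable_geometric) simp
  qed (auto simp: norm_mult norm_power mult_right_mono)
  show "\<forall>\<^sub>F N in sequentially. continuous_on {a. \<forall>n. cmod (a n) \<le> M} (\<lambda>a. \<Sum>n<N. a n * z ^ n)"
    by (intro always_eventually allI continuous_intros continuous_on_subset[OF continuous_on_product_coordinates]) auto
qed auto

text \<open>Tychonoff's theorem, the set being a product of closed discs.\<close>

lemma compact_bounded_coeffs: "compact {a :: nat \<Rightarrow> complex. \<forall>n. cmod (a n) \<le> M}"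
proof -
  have "compactin (product_topology (\<lambda>n::nat. euclidean) UNIV) (\<Pi>\<^sub>E n\<in>UNIV. cball (0::complex) M)"
    by (subst compactin_PiE) auto
  moreover have "(\<Pi>\<^sub>E n\<in>(UNIV::nat set). cball (0::complex) M) = {a. \<forall>n. cmod (a n) \<le> M}"
    by (auto simp: PiE_def Pi_def)
  ultimately show ?thesis by (simp add: euclidean_product_topology)
qed

text \<open>The fraction is the Herglotz kernel (\<zeta> + z) / (\<zeta> - z), with numerator and
  denominator multiplied by the conjugate of \<zeta>.\<close>

lemma poisson_kernel_eq_Re:
  assumes "cmod \<zeta> = 1"
  shows "poisson_kernel z \<zeta> = Re ((1 + cnj \<zeta> * z) / (1 - cnj \<zeta> * z))"
proof -
  define w where "w = cnj \<zeta> * z"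
  have "cmod w = cmod z" using assms by (simp add: w_def norm_mult)
  have "cnj \<zeta> * \<zeta> = 1" using assms complex_norm_square[of \<zeta>] by (simp add: mult.commute)
  then have "1 - w = cnj \<zeta> * (\<zeta> - z)" by (simp add: w_def algebra_simps)
  then have "cmod (1 - w) = cmod (\<zeta> - z)" using assms by (simp add: norm_mult)
  have "Re ((1 + w) / (1 - w)) = Re ((1 + w) * cnj (1 - w)) / (cmod (1 - w))\<^sup>2"
    by (subst complex_div_cnj) (simp flip: of_real_power)
  also have "Re ((1 + w) * cnj (1 - w)) = 1 - (cmod w)\<^sup>2"
    unfolding cmod_power2 by (simp add: power2_eq_square algebra_simps)
  finally show ?thesis
    unfolding poisson_kernel_def w_def[symmetric] \<open>cmod w = cmod z\<close> \<open>cmod (1 - w) = _\<close> ..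
qed

text \<open>With \<open>w = cnj \<zeta> * z\<close> the Herglotz kernel is twice the geometric
  series in \<open>w\<close> minus 1; the subtraction changes the constant coefficient from 2 to
  1.\<close>

lemma poisson_kernel_power_series:
  assumes "cmod \<zeta> = 1" "cmod z < 1"
  shows "poisson_kernel z \<zeta> = Re (\<Sum>n. (if n = 0 then 1 else 2 * cnj \<zeta> ^ n) * z ^ n)"
proof -
  define w where "w = cnj \<zeta> * z"
  have w: "cmod w < 1" using assms by (simp add: w_def norm_mult)
  then have "w \<noteq> 1" by auto
  have "(\<lambda>n. 2 * w ^ n - (if n = 0 then 1 else 0)) sums (2 * (1 / (1 - w)) - 1)"
    by (intro sums_diff sums_mult geometric_sums w sums_single)
  moreover have "(\<lambda>n. 2 * w ^ n - (if n = 0 then 1 else 0))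
      = (\<lambda>n. (if n = 0 then 1 else 2 * cnj \<zeta> ^ n) * z ^ n)"
    by (auto simp: fun_eq_iff w_def power_mult_distrib)
  moreover have "2 * (1 / (1 - w)) - 1 = (1 + w) / (1 - w)"
    using \<open>w \<noteq> 1\<close> by (simp add: field_simps)
  ultimately show ?thesis
    using poisson_kernel_eq_Re[OF assms(1), of z] by (simp add: sums_iff w_def)
qed

text \<open>
  A positive harmonic function $\mathrm{Re} \sum_n a_n z^n$ with value $C$ at $0$ has $|a_n| \le 2C$. Coefficient
  sequences are used instead of functions or boundary measures because their product topology is compact by
  Tychonoff's theorem and limits are harmonic for free.
\<close>

definition positive_coeffs :: "real \<Rightarrow> (nat \<Rightarrow> complex) set" where
  "positive_coeffs C = {a. (\<forall>n. cmod (a n) \<le> 2 * C) \<and> (\<forall>z\<in>ball 0 1. 0 \<le> Re (\<Sum>n. a n * z ^ n))}"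

lemma continuous_on_Re_power_series_coeffs:
  assumes "z \<in> ball 0 1"
  shows "continuous_on {a. \<forall>n. cmod (a n) \<le> M} (\<lambda>a. Re (\<Sum>n. a n * z ^ n))"
  using assms by (intro continuous_on_Re continuous_on_power_series_coeffs) auto

text \<open>Evaluation at \<open>z\<close> is continuous on the compact set \<open>?B\<close>, so
  each positivity condition cuts out a closed subset of it.\<close>

lemma compact_positive_coeffs: "compact (positive_coeffs C)"
proof -
  let ?B = "{a :: nat \<Rightarrow> complex. \<forall>n. cmod (a n) \<le> 2 * C}"
  have "closed (?B \<inter> (\<lambda>a. Re (\<Sum>n. a n * z ^ n)) -` {0..})" if "z \<in> ball 0 1" for z
    using that
    by (intro continuous_closed_preimage continuous_on_Re_power_series_coeffs compact_imp_closed
        compact_bounded_coeffs closed_atLeast)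
  then have "compact (?B \<inter> (\<Inter>z\<in>ball 0 1. ?B \<inter> (\<lambda>a. Re (\<Sum>n. a n * z ^ n)) -` {0..}))"
    by (intro compact_Int_closed compact_bounded_coeffs closed_INT) auto
  moreover have "?B \<inter> (\<Inter>z\<in>ball 0 1. ?B \<inter> (\<lambda>a. Re (\<Sum>n. a n * z ^ n)) -` {0..}) = positive_coeffs C"
    by (auto simp: positive_coeffs_def)
  ultimately show ?thesis by metis
qed

lemma positive_coeffs_convex:
  assumes a: "a \<in> positive_coeffs C" and b: "b \<in> positive_coeffs C" and t: "0 \<le> t" "t \<le> 1"
  obtains c where "c \<in> positive_coeffs C"
    and "\<And>z. z \<in> ball 0 1 \<Longrightarrow> Re (\<Sum>n. c n * z ^ n) =
           (1 - t) * Re (\<Sum>n. a n * z ^ n) + t * Re (\<Sum>n. b n * z ^ n)"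
proof
  define c where "c n = of_real (1 - t) * a n + of_real t * b n" for n
  show eq: "Re (\<Sum>n. c n * z ^ n) = (1 - t) * Re (\<Sum>n. a n * z ^ n) + t * Re (\<Sum>n. b n * z ^ n)"
    if z: "z \<in> ball 0 1" for z
  proof -
    have "(\<lambda>n. a n * z ^ n) sums (\<Sum>n. a n * z ^ n)" "(\<lambda>n. b n * z ^ n) sums (\<Sum>n. b n * z ^ n)"
      using a b z by (auto simp: positive_coeffs_def intro!: summable_sums bounded_coeffs_summable)
    then have "(\<lambda>n. of_real (1 - t) * (a n * z ^ n) + of_real t * (b n * z ^ n)) sums
        (of_real (1 - t) * (\<Sum>n. a n * z ^ n) + of_real t * (\<Sum>n. b n * z ^ n))"
      by (intro sums_add sums_mult)
    then have "(\<Sum>n. c n * z ^ n) = of_real (1 - t) * (\<Sum>n. a n * z ^ n) + of_real t * (\<Sum>n. b n * z ^ n)"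
      by (intro sums_unique[symmetric]) (simp add: c_def algebra_simps)
    then show ?thesis by simp
  qed
  have "cmod (c n) \<le> 2 * C" for n
  proof -
    have "cmod (c n) \<le> (1 - t) * cmod (a n) + t * cmod (b n)"
      using norm_triangle_ineq[of "of_real (1 - t) * a n" "of_real t * b n"] t
      unfolding c_def norm_mult norm_of_real by simp
    also have "\<dots> \<le> 2 * C"
      using a b t by (intro convex_bound_le) (auto simp: positive_coeffs_def)
    finally show ?thesis .
  qed
  moreover have "0 \<le> Re (\<Sum>n. c n * z ^ n)" if "z \<in> ball 0 1" for z
    using a b t that unfolding eq[OF that] positive_coeffs_def by (auto intro!: add_nonneg_nonneg)
  ultimately show "c \<in> positive_coeffs C" by (simp add: positive_coeffs_def)
qed

text \<open>These are the test functions for the dual condition. Their coefficients of positive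
  index have modulus exactly \<open>2 * C\<close>, the bound built into
  \<open>positive_coeffs\<close>.\<close>

lemma positive_coeffs_poisson_kernel:
  assumes \<zeta>: "cmod \<zeta> = 1" and C: "0 \<le> C"
  obtains b where "b \<in> positive_coeffs C"
    and "\<And>z. z \<in> ball 0 1 \<Longrightarrow> Re (\<Sum>n. b n * z ^ n) = C * poisson_kernel z \<zeta>"
proof
  define p where "p n = (if n = 0 then 1 else 2 * cnj \<zeta> ^ n)" for n :: nat
  have p: "cmod (p n) \<le> 2" for n using \<zeta> by (simp add: p_def norm_mult norm_power)
  define b where "b n = of_real C * p n" for n
  show eq: "Re (\<Sum>n. b n * z ^ n) = C * poisson_kernel z \<zeta>" if "z \<in> ball 0 1" for z
  proof -
    have z: "cmod z < 1" using that by simp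
    have "summable (\<lambda>n. p n * z ^ n)" by (rule bounded_coeffs_summable[OF p z])
    from suminf_mult[OF this, of "of_real C"] show ?thesis
      using poisson_kernel_power_series[OF \<zeta> z] by (simp add: b_def mult.assoc p_def)
  qed
  have "cmod (b n) \<le> 2 * C" for n
    using mult_left_mono[OF p[of n] C] C by (simp add: b_def norm_mult mult.commute)
  moreover have "0 \<le> Re (\<Sum>n. b n * z ^ n)" if "z \<in> ball 0 1" for z
    unfolding eq[OF that] using C that by (intro mult_nonneg_nonneg poisson_kernel_nonneg) auto
  ultimately show "b \<in> positive_coeffs C" by (simp add: positive_coeffs_def)
qed

section \<open>The dual condition from finitely supported measures\<close>

text \<open>A \<open>point_measure\<close> lives on the power set of \<open>J\<close>; its image
  under the identity map is the same mass distribution on the Borel sets of \<open>S\<close>, as the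
  integral inequality demands.\<close>

lemma nn_integral_finite_weights:
  assumes J: "finite J" "J \<subseteq> S" and m: "\<And>z. z \<in> J \<Longrightarrow> 0 \<le> m z"
    and g: "g \<in> borel_measurable (restrict_space borel S)" "\<And>z. z \<in> J \<Longrightarrow> 0 \<le> g z"
  shows "(\<integral>\<^sup>+z. ennreal (g z) \<partial>distr (point_measure J (\<lambda>z. ennreal (m z))) (restrict_space borel S) (\<lambda>z. z))
           = ennreal (\<Sum>z\<in>J. m z * g z)"
proof -
  have "(\<integral>\<^sup>+z. ennreal (g z) \<partial>distr (point_measure J (\<lambda>z. ennreal (m z))) (restrict_space borel S) (\<lambda>z. z))
      = (\<Sum>z\<in>J. ennreal (m z) * ennreal (g z))"
    using J g(1) by (subst nn_integral_distr)
      (auto simp: nn_integral_point_measure_finite space_restrict_space)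
  also have "\<dots> = ennreal (\<Sum>z\<in>J. m z * g z)"
    using m g(2) by (simp flip: ennreal_mult)
  finally show ?thesis .
qed

text \<open>The integral inequality is applied to the measure with mass \<open>m z\<close> at each
  \<open>z\<close> in \<open>J\<close>. Its supremum is attained at some \<zeta>, and
  \<open>C\<close> times the Poisson kernel at that \<zeta> is the required member of the
  family.\<close>

lemma positive_coeffs_dual:
  fixes \<phi> :: "complex \<Rightarrow> real"
  assumes \<phi>: "\<phi> \<in> borel_measurable (restrict_space borel (ball 0 1))" "\<And>z. z \<in> ball 0 1 \<Longrightarrow> 0 \<le> \<phi> z"
    and C: "0 \<le> C"
    and bound: "\<And>\<mu> :: complex measure. sets \<mu> = sets (restrict_space borel (ball 0 1)) \<Longrightarrow>
              (\<integral>\<^sup>+z. ennreal (\<phi> z) \<partial>\<mu>)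
                \<le> ennreal C * (SUP \<zeta>\<in>sphere 0 1. \<integral>\<^sup>+z. ennreal (poisson_kernel z \<zeta>) \<partial>\<mu>)"
    and J: "finite J" "J \<subseteq> ball 0 1" and m: "\<And>z. z \<in> J \<Longrightarrow> 0 \<le> m z"
  shows "\<exists>b\<in>positive_coeffs C. (\<Sum>z\<in>J. m z * \<phi> z) \<le> (\<Sum>z\<in>J. m z * Re (\<Sum>n. b n * z ^ n))"
proof -
  define \<mu> where "\<mu> = distr (point_measure J (\<lambda>z. ennreal (m z))) (restrict_space borel (ball 0 1)) (\<lambda>z. z)"
  have P_nonneg: "0 \<le> poisson_kernel z \<zeta>" if "z \<in> J" for z \<zeta>
    using J that by (intro poisson_kernel_nonneg) auto
  \<comment> \<open>\<open>J\<close> lies in the open disc, so no denominator vanishes on the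
    circle, and compactness yields a maximising \<zeta>.\<close>
  have "continuous_on (sphere 0 1) (\<lambda>\<zeta>. \<Sum>z\<in>J. m z * poisson_kernel z \<zeta>)"
    unfolding poisson_kernel_def using J by (intro continuous_intros) auto
  then obtain \<zeta> where \<zeta>: "cmod \<zeta> = 1"
    and max: "\<And>\<xi>. cmod \<xi> = 1 \<Longrightarrow> (\<Sum>z\<in>J. m z * poisson_kernel z \<xi>) \<le> (\<Sum>z\<in>J. m z * poisson_kernel z \<zeta>)"
    using continuous_attains_sup[of "sphere (0::complex) 1"] by fastforce
  have "ennreal (\<Sum>z\<in>J. m z * \<phi> z) = (\<integral>\<^sup>+z. ennreal (\<phi> z) \<partial>\<mu>)"
    unfolding \<mu>_def using J m \<phi> by (intro nn_integral_finite_weights[symmetric]) auto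
  also have "\<dots> \<le> ennreal C * (SUP \<zeta>\<in>sphere 0 1. \<integral>\<^sup>+z. ennreal (poisson_kernel z \<zeta>) \<partial>\<mu>)"
    by (rule bound) (simp add: \<mu>_def)
  also have "\<dots> = ennreal C * (SUP \<zeta>\<in>sphere 0 1. ennreal (\<Sum>z\<in>J. m z * poisson_kernel z \<zeta>))"
    unfolding \<mu>_def using J m P_nonneg
    by (intro arg_cong2[where f = "(*)"] SUP_cong refl nn_integral_finite_weights measurable_restrict_space1)
       (auto simp: poisson_kernel_def)
  also have "\<dots> \<le> ennreal C * ennreal (\<Sum>z\<in>J. m z * poisson_kernel z \<zeta>)"
    using max by (intro mult_left_mono SUP_least ennreal_leI) auto
  also have "\<dots> = ennreal (\<Sum>z\<in>J. m z * (C * poisson_kernel z \<zeta>))"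
    using C m P_nonneg by (subst ennreal_mult[symmetric]) (auto intro!: sum_nonneg simp: sum_distrib_left mult_ac)
  finally have "(\<Sum>z\<in>J. m z * \<phi> z) \<le> (\<Sum>z\<in>J. m z * (C * poisson_kernel z \<zeta>))"
    using C m P_nonneg by (subst (asm) ennreal_le_iff) (auto intro!: sum_nonneg)
  moreover obtain b where b: "b \<in> positive_coeffs C"
    "\<And>z. z \<in> ball 0 1 \<Longrightarrow> Re (\<Sum>n. b n * z ^ n) = C * poisson_kernel z \<zeta>"
    using positive_coeffs_poisson_kernel[OF \<zeta> C] by blast
  moreover have "(\<Sum>z\<in>J. m z * Re (\<Sum>n. b n * z ^ n)) = (\<Sum>z\<in>J. m z * (C * poisson_kernel z \<zeta>))"
    using J b(2) by (intro sum.cong) auto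
  ultimately show ?thesis by (intro bexI[OF _ b(1)]) linarith
qed

text \<open>The duality principle with the points of the disc as indices and evaluation of the power
  series at \<open>z\<close> as \<open>e z\<close>.\<close>

lemma positive_coeffs_dominating:
  fixes \<phi> :: "complex \<Rightarrow> real"
  assumes \<phi>: "\<phi> \<in> borel_measurable (restrict_space borel (ball 0 1))" "\<And>z. z \<in> ball 0 1 \<Longrightarrow> 0 \<le> \<phi> z"
    and C: "0 \<le> C"
    and bound: "\<And>\<mu> :: complex measure. sets \<mu> = sets (restrict_space borel (ball 0 1)) \<Longrightarrow>
              (\<integral>\<^sup>+z. ennreal (\<phi> z) \<partial>\<mu>)
                \<le> ennreal C * (SUP \<zeta>\<in>sphere 0 1. \<integral>\<^sup>+z. ennreal (poisson_kernel z \<zeta>) \<partial>\<mu>)"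
  shows "\<exists>a\<in>positive_coeffs C. \<forall>z\<in>ball 0 1. \<phi> z \<le> Re (\<Sum>n. a n * z ^ n)"
proof (rule convexlike_dominating_point[OF compact_positive_coeffs])
  show "continuous_on (positive_coeffs C) (\<lambda>a. Re (\<Sum>n. a n * z ^ n))" if "z \<in> ball 0 1" for z
    by (rule continuous_on_subset[OF continuous_on_Re_power_series_coeffs[OF that, of "2 * C"]])
       (auto simp: positive_coeffs_def)
next
  fix a b and t :: real
  assume "a \<in> positive_coeffs C" "b \<in> positive_coeffs C" "0 \<le> t" "t \<le> 1"
  then obtain c where "c \<in> positive_coeffs C"
    and "\<And>z. z \<in> ball 0 1 \<Longrightarrow> Re (\<Sum>n. c n * z ^ n) =
           (1 - t) * Re (\<Sum>n. a n * z ^ n) + t * Re (\<Sum>n. b n * z ^ n)"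
    using positive_coeffs_convex by blast
  then show "\<exists>c\<in>positive_coeffs C. \<forall>z\<in>ball 0 1.
      (1 - t) * Re (\<Sum>n. a n * z ^ n) + t * Re (\<Sum>n. b n * z ^ n) \<le> Re (\<Sum>n. c n * z ^ n)"
    by (intro bexI[of _ c]) auto
next
  fix J m assume J: "finite J" "J \<subseteq> ball (0 :: complex) 1" "\<And>z. z \<in> J \<Longrightarrow> 0 \<le> (m z :: real)"
  show "\<exists>b\<in>positive_coeffs C. (\<Sum>z\<in>J. m z * \<phi> z) \<le> (\<Sum>z\<in>J. m z * Re (\<Sum>n. b n * z ^ n))"
    by (rule positive_coeffs_dual) (fact assms J)+
qed

lemma holomorphic_on_positive_coeffs:
  assumes "a \<in> positive_coeffs C"
  shows "(\<lambda>z. \<Sum>n. a n * z ^ n) holomorphic_on ball 0 1"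
proof (rule power_series_holomorphic)
  show "(\<lambda>n. a n * (z - 0) ^ n) sums (\<Sum>n. a n * z ^ n)" if "z \<in> ball 0 1" for z
    using assms that bounded_coeffs_summable[of a "2 * C" z]
    by (simp add: positive_coeffs_def summable_sums)
qed

section \<open>Equivalence of harmonic domination and the Poisson inequality\<close>

theorem theorem1p4:
  fixes \<phi> :: "complex \<Rightarrow> real"
  assumes "\<phi> \<in> borel_measurable (restrict_space borel (ball 0 1))"
    and "\<And>z. z \<in> ball 0 1 \<Longrightarrow> 0 \<le> \<phi> z"
  shows "(\<exists>h. harmonic_on (ball 0 1) h \<and> (\<forall>z\<in>ball 0 1. 0 \<le> h z) \<and> (\<forall>z\<in>ball 0 1. \<phi> z \<le> h z))
     \<longleftrightarrow> (\<exists>C::real. 0 \<le> C \<and>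
           (\<forall>\<mu> :: complex measure. sets \<mu> = sets (restrict_space borel (ball 0 1)) \<longrightarrow>
              (\<integral>\<^sup>+z. ennreal (\<phi> z) \<partial>\<mu>)
                \<le> ennreal C * (SUP \<zeta>\<in>sphere 0 1. \<integral>\<^sup>+z. ennreal (poisson_kernel z \<zeta>) \<partial>\<mu>)))"
proof
  assume "\<exists>h. harmonic_on (ball 0 1) h \<and> (\<forall>z\<in>ball 0 1. 0 \<le> h z) \<and> (\<forall>z\<in>ball 0 1. \<phi> z \<le> h z)"
  then obtain h where h: "harmonic_on (ball 0 1) h" "\<And>z. z \<in> ball 0 1 \<Longrightarrow> 0 \<le> h z"
    "\<And>z. z \<in> ball 0 1 \<Longrightarrow> \<phi> z \<le> h z" by blast
  obtain F where F: "F holomorphic_on ball 0 1" "\<And>z. z \<in> ball 0 1 \<Longrightarrow> h z = Re (F z)"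
    using harmonic_on_convex_imp_Re_holomorphic[OF h(1) convex_ball] by blast
  have F_pos: "0 \<le> Re (F z)" if "z \<in> ball 0 1" for z
    using h(2)[OF that] F(2)[OF that] by simp
  show "\<exists>C::real. 0 \<le> C \<and>
           (\<forall>\<mu> :: complex measure. sets \<mu> = sets (restrict_space borel (ball 0 1)) \<longrightarrow>
              (\<integral>\<^sup>+z. ennreal (\<phi> z) \<partial>\<mu>)
                \<le> ennreal C * (SUP \<zeta>\<in>sphere 0 1. \<integral>\<^sup>+z. ennreal (poisson_kernel z \<zeta>) \<partial>\<mu>))"
  \<comment> \<open>The summand 1 keeps the right-hand side infinite when the supremum is, even if \<open>h = 0\<close>.\<close>
  proof (intro exI[of _ "Re (F 0) + 1"] conjI allI impI)
    fix \<mu> :: "complex measure"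
    assume sets_\<mu>: "sets \<mu> = sets (restrict_space borel (ball 0 1))"
    define S where "S = (SUP \<zeta>\<in>sphere 0 1. \<integral>\<^sup>+z. ennreal (poisson_kernel z \<zeta>) \<partial>\<mu>)"
    have "(\<integral>\<^sup>+z. ennreal (\<phi> z) \<partial>\<mu>) \<le> ennreal (Re (F 0) + 1) * S"
    \<comment> \<open>Only a finite supremum gives the sigma-finiteness behind the estimate;
      otherwise the right-hand side is infinite.\<close>
    proof (cases "S < \<infinity>")
      case True
      have "space \<mu> = ball 0 1"
        using sets_eq_imp_space_eq[OF sets_\<mu>] by (simp add: space_restrict_space)
      then have "(\<integral>\<^sup>+z. ennreal (\<phi> z) \<partial>\<mu>) \<le> (\<integral>\<^sup>+z. ennreal (Re (F z)) \<partial>\<mu>)"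
        using h(3) F(2) by (intro nn_integral_mono ennreal_leI) auto
      also have "\<dots> \<le> ennreal (Re (F 0)) * S"
        using nn_integral_Re_le_SUP_poisson[OF F(1) F_pos sets_\<mu>] True unfolding S_def by blast
      also have "\<dots> \<le> ennreal (Re (F 0) + 1) * S"
        by (intro mult_right_mono ennreal_leI) auto
      finally show ?thesis .
    next
      case False
      then have "S = top" by (simp add: less_top[symmetric])
      moreover have "0 < ennreal (Re (F 0) + 1)" using F_pos[of 0] by (simp del: ennreal_plus)
      ultimately show ?thesis by (simp add: ennreal_mult_top)
    qed
    then show "(\<integral>\<^sup>+z. ennreal (\<phi> z) \<partial>\<mu>)
        \<le> ennreal (Re (F 0) + 1) * (SUP \<zeta>\<in>sphere 0 1. \<integral>\<^sup>+z. ennreal (poisson_kernel z \<zeta>) \<partial>\<mu>)"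
      unfolding S_def .
  qed (use F_pos[of 0] in simp)
next
  assume "\<exists>C::real. 0 \<le> C \<and>
           (\<forall>\<mu> :: complex measure. sets \<mu> = sets (restrict_space borel (ball 0 1)) \<longrightarrow>
              (\<integral>\<^sup>+z. ennreal (\<phi> z) \<partial>\<mu>)
                \<le> ennreal C * (SUP \<zeta>\<in>sphere 0 1. \<integral>\<^sup>+z. ennreal (poisson_kernel z \<zeta>) \<partial>\<mu>))"
  then obtain C :: real where C: "0 \<le> C"
    and bound: "\<And>\<mu> :: complex measure. sets \<mu> = sets (restrict_space borel (ball 0 1)) \<Longrightarrow>
              (\<integral>\<^sup>+z. ennreal (\<phi> z) \<partial>\<mu>)
                \<le> ennreal C * (SUP \<zeta>\<in>sphere 0 1. \<integral>\<^sup>+z. ennreal (poisson_kernel z \<zeta>) \<partial>\<mu>)"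
    by blast
  have "\<exists>a\<in>positive_coeffs C. \<forall>z\<in>ball 0 1. \<phi> z \<le> Re (\<Sum>n. a n * z ^ n)"
    by (rule positive_coeffs_dominating) (fact assms C bound)+
  then obtain a where a: "a \<in> positive_coeffs C"
    and dom: "\<forall>z\<in>ball 0 1. \<phi> z \<le> Re (\<Sum>n. a n * z ^ n)" by blast
  show "\<exists>h. harmonic_on (ball 0 1) h \<and> (\<forall>z\<in>ball 0 1. 0 \<le> h z) \<and> (\<forall>z\<in>ball 0 1. \<phi> z \<le> h z)"
  proof (intro exI[of _ "\<lambda>z. Re (\<Sum>n. a n * z ^ n)"] conjI)
    show "harmonic_on (ball 0 1) (\<lambda>z. Re (\<Sum>n. a n * z ^ n))"
      by (rule harmonic_on_Re_holomorphic[OF holomorphic_on_positive_coeffs[OF a] open_ball])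
    show "\<forall>z\<in>ball 0 1. 0 \<le> Re (\<Sum>n. a n * z ^ n)"
      using a by (simp add: positive_coeffs_def)
  qed (rule dom)
qed

end
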